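(* Let $(\Xi,\rho,\theta,\Sigma)$ be a continuous groupoid action with $\Xi$ strongly non-compact, and let $\sigma\in\Sigma$. (i) All the points in the orbit of $\sigma$ have the same limit set $\mathfrak L_\sigma$. One has $\overline{\mathfrak O}_\sigma=\mathfrak O_\sigma\cup\mathfrak L_\sigma$. (ii) If $\Xi$ is open and locally compact, the closed set $\mathfrak L_\sigma$ is invariant. (iii) If the orbit of $\sigma$ is relatively compact, $\mathfrak L_\sigma$ is non-empty and it attracts the points of the orbit $\mathfrak O_\sigma$: for every neighborhood $W$ of $\mathfrak L_\sigma$ there is a compact subset $\mathsf k$ of $\Xi_{\rho(\sigma)}$ such that $(\Xi_{\rho(\sigma)}\setminus\mathsf k)\bullet\sigma\subset W$.
   Context: All topological spaces are Hausdorff. A groupoid $\Xi$ is a small category in which all arrows are invertible; $X=\Xi^{(0)}$ is its unit space, $d,r:\Xi\to X$ are the source and range maps, and $\xi\eta$ is defined iff $d(\xi)=r(\eta)$. A topological groupoid is a groupoid with a (Hausdorff) topology making inversion and multiplication continuous (composable pairs carry the topology induced from $\Xi\times\Xi$); $X$ has the subspace topology. $\Xi$ is called open if $d:\Xi\to X$ is an open map. For $x\in X$, $\Xi_x=d^{-1}(\{x\})$. $\Xi$ is strongly non-compact if $\Xi_x$ is non-compact for every $x\in X$. A continuous groupoid action $(\Xi,\rho,\theta,\Sigma)$ consists of a topological groupoid $\Xi$, a Hausdorff space $\Sigma$, a continuous surjection $\rho:\Sigma\to X$ (the anchor) and a continuous map $\theta:\{(\xi,\sigma)\in\Xi\times\Sigma: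 d(\xi)=\rho(\sigma)\}\to\Sigma$, $\theta_\xi(\sigma)=\xi\bullet\sigma$, with $\rho(\sigma)\bullet\sigma=\sigma$ and: if $d(\xi)=r(\eta)$ and $d(\eta)=\rho(\sigma)$ then $d(\xi)=\rho(\eta\bullet\sigma)$ and $(\xi\eta)\bullet\sigma=\xi\bullet(\eta\bullet\sigma)$. For $\mathsf A\subset\Xi$, $M\subset\Sigma$: $\mathsf A\bullet M=\{\xi\bullet\tau:\xi\in\mathsf A,\ \tau\in M,\ d(\xi)=\rho(\tau)\}$, with $\mathsf A\bullet\sigma=\mathsf A\bullet\{\sigma\}$ and $\xi\bullet M=\{\xi\}\bullet M$. $M$ is invariant if $\xi\bullet M\subset M$ for all $\xi\in\Xi$. The orbit of $\sigma$ is $\mathfrak O_\sigma=\Xi_{\rho(\sigma)}\bullet\sigma$, with closure $\overline{\mathfrak O}_\sigma$. The limit set of $\sigma$ is the closed set $\mathfrak L_\sigma=\bigcap_{\mathsf K}\overline{(\Xi\setminus\mathsf K)\bullet\sigma}$, the intersection being over all compact subsets $\mathsf K$ of $\Xi$. Relatively compact means having compact closure. *)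

theory Defs
  imports "HOL-Analysis.Analysis"
begin

(* Objects of the category are identified with their identity arrows, so that the unit space is
   a subset of the set of arrows and src, rng take values in arrows. The operations are total
   functions; their values off the intended domains are unconstrained. *)
record 'g groupoid =
  arrows :: "'g set"
  units :: "'g set"
  src :: "'g \<Rightarrow> 'g"
  rng :: "'g \<Rightarrow> 'g"
  gmult :: "'g \<Rightarrow> 'g \<Rightarrow> 'g"
  ginv :: "'g \<Rightarrow> 'g"

record 'g top_groupoid = "'g groupoid" +
  arrow_top :: "'g topology"

record ('g, 's) groupoid_action = "'g top_groupoid" +
  space_top :: "'s topology"
  anchor :: "'s \<Rightarrow> 'g"
  act :: "'g \<Rightarrow> 's \<Rightarrow> 's"

locale groupoid =
  fixes G :: "('g, 'm) groupoid_scheme"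
  assumes units_subset: "units G \<subseteq> arrows G"
    and src_unit: "\<xi> \<in> arrows G \<Longrightarrow> src G \<xi> \<in> units G"
    and rng_unit: "\<xi> \<in> arrows G \<Longrightarrow> rng G \<xi> \<in> units G"
    and src_of_unit: "x \<in> units G \<Longrightarrow> src G x = x"
    and rng_of_unit: "x \<in> units G \<Longrightarrow> rng G x = x"
    and mult_closed: "\<lbrakk>\<xi> \<in> arrows G; \<eta> \<in> arrows G; src G \<xi> = rng G \<eta>\<rbrakk>
          \<Longrightarrow> gmult G \<xi> \<eta> \<in> arrows G"
    and src_mult: "\<lbrakk>\<xi> \<in> arrows G; \<eta> \<in> arrows G; src G \<xi> = rng G \<eta>\<rbrakk>
          \<Longrightarrow> src G (gmult G \<xi> \<eta>) = src G \<eta>"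
    and rng_mult: "\<lbrakk>\<xi> \<in> arrows G; \<eta> \<in> arrows G; src G \<xi> = rng G \<eta>\<rbrakk>
          \<Longrightarrow> rng G (gmult G \<xi> \<eta>) = rng G \<xi>"
    and mult_assoc: "\<lbrakk>\<xi> \<in> arrows G; \<eta> \<in> arrows G; \<zeta> \<in> arrows G;
            src G \<xi> = rng G \<eta>; src G \<eta> = rng G \<zeta>\<rbrakk>
          \<Longrightarrow> gmult G (gmult G \<xi> \<eta>) \<zeta> = gmult G \<xi> (gmult G \<eta> \<zeta>)"
    and unit_left: "\<xi> \<in> arrows G \<Longrightarrow> gmult G (rng G \<xi>) \<xi> = \<xi>"
    and unit_right: "\<xi> \<in> arrows G \<Longrightarrow> gmult G \<xi> (src G \<xi>) = \<xi>"
    and inv_closed: "\<xi> \<in> arrows G \<Longrightarrow> ginv G \<xi> \<in> arrows G"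
    and src_inv: "\<xi> \<in> arrows G \<Longrightarrow> src G (ginv G \<xi>) = rng G \<xi>"
    and rng_inv: "\<xi> \<in> arrows G \<Longrightarrow> rng G (ginv G \<xi>) = src G \<xi>"
    and inv_left: "\<xi> \<in> arrows G \<Longrightarrow> gmult G (ginv G \<xi>) \<xi> = src G \<xi>"
    and inv_right: "\<xi> \<in> arrows G \<Longrightarrow> gmult G \<xi> (ginv G \<xi>) = rng G \<xi>"

definition unit_top :: "('g, 'm) top_groupoid_scheme \<Rightarrow> 'g topology" where
  "unit_top G = subtopology (arrow_top G) (units G)"

(* Continuity of src and rng is not assumed: it follows from that of ginv and gmult. *)
locale topological_groupoid = groupoid G
  for G :: "('g, 'm) top_groupoid_scheme" +
  assumes topspace_arrow: "topspace (arrow_top G) = arrows G"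
    and Hausdorff_arrow: "Hausdorff_space (arrow_top G)"
    and continuous_inv: "continuous_map (arrow_top G) (arrow_top G) (ginv G)"
    and continuous_mult: "continuous_map
          (subtopology (prod_topology (arrow_top G) (arrow_top G)) {(\<xi>, \<eta>). src G \<xi> = rng G \<eta>})
          (arrow_top G) (\<lambda>(\<xi>, \<eta>). gmult G \<xi> \<eta>)"

definition open_groupoid :: "('g, 'm) top_groupoid_scheme \<Rightarrow> bool" where
  "open_groupoid G \<longleftrightarrow> open_map (arrow_top G) (unit_top G) (src G)"

definition src_fibre :: "('g, 'm) groupoid_scheme \<Rightarrow> 'g \<Rightarrow> 'g set" where
  "src_fibre G x = {\<xi> \<in> arrows G. src G \<xi> = x}"

definition strongly_noncompact :: "('g, 'm) top_groupoid_scheme \<Rightarrow> bool" where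
  "strongly_noncompact G \<longleftrightarrow> (\<forall>x\<in>units G. \<not> compactin (arrow_top G) (src_fibre G x))"

(* The equation for the anchor of act A eta sigma in act_anchor is the definedness of the
   right-hand side of act_mult. *)
locale continuous_groupoid_action = topological_groupoid A
  for A :: "('g, 's, 'm) groupoid_action_scheme" +
  assumes Hausdorff_space: "Hausdorff_space (space_top A)"
    and continuous_anchor: "continuous_map (space_top A) (unit_top A) (anchor A)"
    and anchor_surj: "anchor A ` topspace (space_top A) = units A"
    and continuous_act: "continuous_map
          (subtopology (prod_topology (arrow_top A) (space_top A)) {(\<xi>, \<sigma>). src A \<xi> = anchor A \<sigma>})
          (space_top A) (\<lambda>(\<xi>, \<sigma>). act A \<xi> \<sigma>)"
    and act_unit: "\<sigma> \<in> topspace (space_top A) \<Longrightarrow> act A (anchor A \<sigma>) \<sigma> = \<sigma>"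
    and act_anchor: "\<lbrakk>\<xi> \<in> arrows A; \<eta> \<in> arrows A; \<sigma> \<in> topspace (space_top A);
            src A \<xi> = rng A \<eta>; src A \<eta> = anchor A \<sigma>\<rbrakk>
          \<Longrightarrow> src A \<xi> = anchor A (act A \<eta> \<sigma>)"
    and act_mult: "\<lbrakk>\<xi> \<in> arrows A; \<eta> \<in> arrows A; \<sigma> \<in> topspace (space_top A);
            src A \<xi> = rng A \<eta>; src A \<eta> = anchor A \<sigma>\<rbrakk>
          \<Longrightarrow> act A (gmult A \<xi> \<eta>) \<sigma> = act A \<xi> (act A \<eta> \<sigma>)"

definition act_set ::
  "('g, 's, 'm) groupoid_action_scheme \<Rightarrow> 'g set \<Rightarrow> 's set \<Rightarrow> 's set" where
  "act_set A B M = {act A \<xi> \<tau> | \<xi> \<tau>. \<xi> \<in> B \<and> \<tau> \<in> M \<and> src A \<xi> = anchor A \<tau>}"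

definition invariant_set :: "('g, 's, 'm) groupoid_action_scheme \<Rightarrow> 's set \<Rightarrow> bool" where
  "invariant_set A M \<longleftrightarrow>
     M \<subseteq> topspace (space_top A) \<and> (\<forall>\<xi>\<in>arrows A. act_set A {\<xi>} M \<subseteq> M)"

definition orbit_of :: "('g, 's, 'm) groupoid_action_scheme \<Rightarrow> 's \<Rightarrow> 's set" where
  "orbit_of A \<sigma> = act_set A (src_fibre A (anchor A \<sigma>)) {\<sigma>}"

definition limit_set :: "('g, 's, 'm) groupoid_action_scheme \<Rightarrow> 's \<Rightarrow> 's set" where
  "limit_set A \<sigma> =
     (\<Inter>K \<in> {K. compactin (arrow_top A) K}. space_top A closure_of act_set A (arrows A - K) {\<sigma>})"

definition relatively_compactin :: "'a topology \<Rightarrow> 'a set \<Rightarrow> bool" where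
  "relatively_compactin T S \<longleftrightarrow> S \<subseteq> topspace T \<and> compactin T (T closure_of S)"

(* Neighbourhoods of a set need not be open. *)
definition neighbourhood_of_set :: "'a topology \<Rightarrow> 'a set \<Rightarrow> 'a set \<Rightarrow> bool" where
  "neighbourhood_of_set T S W \<longleftrightarrow> W \<subseteq> topspace T \<and> (\<exists>U. openin T U \<and> S \<subseteq> U \<and> U \<subseteq> W)"

end

theory Submission
  imports Defs
begin

text \<open>
  Write \<open>x\<close> for the anchor of \<open>\<sigma>\<close>, and call the set of all \<open>\<xi> \<bullet> \<sigma>\<close> with \<open>\<xi> \<notin> K\<close> the tail of
  the orbit avoiding \<open>K\<close>. Everything rests on compactness facts that follow from the Hausdorff
  property and the continuity of source and range. The composable pairs form a closed set, so that
  the product of two compact sets of arrows is compact. The source fibres are closed, so that they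
  meet a compact set of arrows \<open>K\<close> in a compact set, and its image \<open>K \<bullet> \<sigma>\<close> is compact.

  (i) Right translation by an arrow \<open>\<xi>\<close> from \<open>x\<close> to \<open>y\<close>
  identifies the source fibre at \<open>y\<close> with that at \<open>x\<close> and carries
  compact sets to compact sets, so the tails of the orbit seen from \<open>\<sigma>\<close> are
  cofinal with those seen from \<open>\<xi> \<bullet> \<sigma>\<close>. Further, for
  \<open>K\<close> compact the orbit is the union of \<open>K \<bullet> \<sigma>\<close> and the
  tail avoiding \<open>K\<close>. The former is compact and therefore closed, hence a point of the
  orbit closure which is not in the orbit lies in the closure of every tail.

  (ii) Let \<open>\<tau>\<close> be a limit point and \<open>\<eta> \<bullet> \<tau> \<in> W\<close> with \<open>W\<close> open. Some neighbourhood \<open>U\<close> of \<open>\<eta>\<close>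
  inside a compact set \<open>C\<close> and some neighbourhood \<open>V\<close> of \<open>\<tau>\<close> satisfy \<open>U \<bullet> V \<subseteq> W\<close>. Openness of the
  source map allows every point of \<open>V\<close> near enough to \<open>\<tau>\<close> to be moved by some arrow of \<open>U\<close>; applied
  to points \<open>\<xi> \<bullet> \<sigma>\<close> with \<open>\<xi>\<close> outside the compact set \<open>C\<inverse>K\<close>, this gives points of \<open>W\<close> in the
  tail avoiding \<open>K\<close>.

  (iii) The closures of the tails form a downward directed family of closed subsets of a compact
  set, so one of them is already contained in any given neighbourhood of their intersection. That
  the intersection is non-empty is the case of the empty neighbourhood: a tail avoiding a compact
  set is never empty when the fibre is not compact.
\<close>

section \<open>Compact sets of arrows\<close>

context topological_groupoid
begin

lemma continuous_map_gmult:
  assumes "continuous_map Z (arrow_top G) f" "continuous_map Z (arrow_top G) g"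
    and "\<And>z. z \<in> topspace Z \<Longrightarrow> src G (f z) = rng G (g z)"
  shows "continuous_map Z (arrow_top G) (\<lambda>z. gmult G (f z) (g z))"
proof -
  have "continuous_map Z (subtopology (prod_topology (arrow_top G) (arrow_top G))
          {(\<xi>, \<eta>). src G \<xi> = rng G \<eta>}) (\<lambda>z. (f z, g z))"
    using assms by (auto simp: continuous_map_in_subtopology continuous_map_paired)
  from continuous_map_compose[OF this continuous_mult] show ?thesis
    by (simp add: o_def)
qed

text \<open>The source of \<open>\<xi>\<close> is \<open>\<xi>\<inverse>\<xi>\<close>, which is continuous in \<open>\<xi>\<close>.\<close>

lemma continuous_map_src: "continuous_map (arrow_top G) (arrow_top G) (src G)"
proof -
  have "continuous_map (arrow_top G) (arrow_top G) (\<lambda>\<xi>. gmult G (ginv G \<xi>) \<xi>)"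
    by (rule continuous_map_gmult) (auto simp: continuous_inv topspace_arrow src_inv)
  then show ?thesis
    by (rule continuous_map_eq) (simp add: topspace_arrow inv_left)
qed

lemma continuous_map_rng: "continuous_map (arrow_top G) (arrow_top G) (rng G)"
  using continuous_map_compose[OF continuous_inv continuous_map_src]
  by (rule continuous_map_eq) (simp add: topspace_arrow src_inv)

lemma closedin_src_fibre: "closedin (arrow_top G) (src_fibre G x)"
proof -
  have "closedin (arrow_top G) {\<xi> \<in> topspace (arrow_top G). src G \<xi> \<in> {x}}" if "x \<in> arrows G"
    by (rule closedin_continuous_map_preimage[OF continuous_map_src])
       (simp add: closedin_Hausdorff_singleton Hausdorff_arrow topspace_arrow that)
  moreover have "src_fibre G x = {}" if "x \<notin> arrows G"
    using that src_unit units_subset by (auto simp: src_fibre_def)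
  moreover have "src_fibre G x = {\<xi> \<in> topspace (arrow_top G). src G \<xi> \<in> {x}}"
    by (simp add: src_fibre_def topspace_arrow)
  ultimately show ?thesis
    by (metis closedin_empty)
qed

definition arrow_product :: "'g set \<Rightarrow> 'g set \<Rightarrow> 'g set" where
  "arrow_product B C = {gmult G \<xi> \<eta> |\<xi> \<eta>. \<xi> \<in> B \<and> \<eta> \<in> C \<and> src G \<xi> = rng G \<eta>}"

text \<open>The composable pairs are the coincidence set of two continuous maps into a Hausdorff space.
  Hence they form a closed subset of the compact set \<open>B \<times> C\<close>, whose image is \<open>arrow_product B C\<close>.\<close>

lemma compactin_arrow_product:
  assumes "compactin (arrow_top G) B" "compactin (arrow_top G) C"
  shows "compactin (arrow_top G) (arrow_product B C)"
proof -
  let ?P = "prod_topology (arrow_top G) (arrow_top G)"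
  let ?D = "{p \<in> topspace ?P. (src G \<circ> fst) p = (rng G \<circ> snd) p}"
  have "closedin ?P ?D"
    by (intro closedin_continuous_maps_eq[OF Hausdorff_arrow]
          continuous_map_compose[OF continuous_map_fst continuous_map_src]
          continuous_map_compose[OF continuous_map_snd continuous_map_rng])
  then have "compactin ?P (?D \<inter> B \<times> C)"
    by (intro closed_Int_compactin) (auto simp: compactin_Times assms)
  then have "compactin (subtopology ?P {(\<xi>, \<eta>). src G \<xi> = rng G \<eta>}) (?D \<inter> B \<times> C)"
    by (auto simp: compactin_subtopology)
  from image_compactin[OF this continuous_mult]
  have "compactin (arrow_top G) ((\<lambda>(\<xi>, \<eta>). gmult G \<xi> \<eta>) ` (?D \<inter> B \<times> C))" .
  also have "(\<lambda>(\<xi>, \<eta>). gmult G \<xi> \<eta>) ` (?D \<inter> B \<times> C) = arrow_product B C"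
    using assms[THEN compactin_subset_topspace] by (force simp: arrow_product_def)
  finally show ?thesis .
qed

end

section \<open>Orbits and their tails\<close>

context continuous_groupoid_action
begin

lemma anchor_unit: "\<sigma> \<in> topspace (space_top A) \<Longrightarrow> anchor A \<sigma> \<in> units A"
  using anchor_surj by blast

lemma act_closed:
  assumes "\<xi> \<in> arrows A" "\<sigma> \<in> topspace (space_top A)" "src A \<xi> = anchor A \<sigma>"
  shows "act A \<xi> \<sigma> \<in> topspace (space_top A)"
  using continuous_map_image_subset_topspace[OF continuous_act] assms
  by (force simp: topspace_arrow)

text \<open>The action axiom on anchors only speaks of arrows composable with \<open>\<xi>\<close>; the unit at the range
  of \<open>\<xi>\<close> is one of them and determines the anchor.\<close>

lemma anchor_act:
  assumes "\<xi> \<in> arrows A" "\<sigma> \<in> topspace (space_top A)" "src A \<xi> = anchor A \<sigma>"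
  shows "anchor A (act A \<xi> \<sigma>) = rng A \<xi>"
  using act_anchor[of "rng A \<xi>" \<xi> \<sigma>] assms rng_unit[of \<xi>] src_of_unit[of "rng A \<xi>"] units_subset
  by auto

lemma act_inv_act:
  assumes "\<xi> \<in> arrows A" "\<sigma> \<in> topspace (space_top A)" "src A \<xi> = anchor A \<sigma>"
  shows "act A (ginv A \<xi>) (act A \<xi> \<sigma>) = \<sigma>"
  using act_mult[of "ginv A \<xi>" \<xi> \<sigma>] assms by (simp add: inv_closed src_inv inv_left act_unit)

text \<open>Only the arrows of \<open>K\<close> in the source fibre at the anchor of \<open>\<sigma>\<close> act on \<open>\<sigma>\<close>; they form a
  compact set because the fibre is closed.\<close>

lemma compactin_act_point:
  assumes "compactin (arrow_top A) K" "\<sigma> \<in> topspace (space_top A)"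
  shows "compactin (space_top A) (act_set A K {\<sigma>})"
proof -
  let ?F = "src_fibre A (anchor A \<sigma>)"
  have "compactin (arrow_top A) (?F \<inter> K)"
    by (rule closed_Int_compactin[OF closedin_src_fibre assms(1)])
  then have "compactin (subtopology (arrow_top A) ?F) (?F \<inter> K)"
    by (simp add: compactin_subtopology)
  moreover have "continuous_map (subtopology (arrow_top A) ?F) (space_top A) (\<lambda>\<xi>. act A \<xi> \<sigma>)"
  proof -
    have "continuous_map (subtopology (arrow_top A) ?F)
        (subtopology (prod_topology (arrow_top A) (space_top A)) {(\<xi>, \<sigma>). src A \<xi> = anchor A \<sigma>})
        (\<lambda>\<xi>. (\<xi>, \<sigma>))"
      using assms(2)
      by (auto simp: continuous_map_in_subtopology continuous_map_paired src_fibre_def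
          intro: continuous_map_from_subtopology)
    from continuous_map_compose[OF this continuous_act] show ?thesis
      by (simp add: o_def)
  qed
  ultimately have "compactin (space_top A) ((\<lambda>\<xi>. act A \<xi> \<sigma>) ` (?F \<inter> K))"
    by (rule image_compactin)
  also have "(\<lambda>\<xi>. act A \<xi> \<sigma>) ` (?F \<inter> K) = act_set A K {\<sigma>}"
    using compactin_subset_topspace[OF assms(1)]
    by (auto simp: act_set_def src_fibre_def topspace_arrow)
  finally show ?thesis .
qed

lemma orbit_of_eq: "orbit_of A \<sigma> = act_set A (arrows A) {\<sigma>}"
  by (auto simp: orbit_of_def act_set_def src_fibre_def)

lemma orbit_subset_topspace:
  "\<sigma> \<in> topspace (space_top A) \<Longrightarrow> orbit_of A \<sigma> \<subseteq> topspace (space_top A)"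
  by (auto simp: orbit_of_eq act_set_def intro: act_closed)

lemma closedin_limit_set: "closedin (space_top A) (limit_set A \<sigma>)"
  unfolding limit_set_def
proof (rule closedin_Inter)
  show "(\<lambda>K. space_top A closure_of act_set A (arrows A - K) {\<sigma>}) ` {K. compactin (arrow_top A) K} \<noteq> {}"
    using compactin_empty by blast
qed auto

section \<open>Independence of the base point and the orbit closure\<close>

text \<open>With \<open>K' = K\<xi>\<close>, the tail of \<open>\<sigma>\<close> avoiding \<open>K'\<close> lies in the tail of \<open>\<xi> \<bullet> \<sigma>\<close> avoiding \<open>K\<close>:
  for \<open>\<zeta> \<notin> K\<xi>\<close> the point \<open>\<zeta> \<bullet> \<sigma>\<close> is \<open>\<zeta>\<xi>\<inverse> \<bullet> (\<xi> \<bullet> \<sigma>)\<close>, and \<open>\<zeta>\<xi>\<inverse> \<notin> K\<close>.\<close>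

lemma limit_set_act_subset:
  assumes \<sigma>: "\<sigma> \<in> topspace (space_top A)" and \<xi>: "\<xi> \<in> arrows A" "src A \<xi> = anchor A \<sigma>"
  shows "limit_set A \<sigma> \<subseteq> limit_set A (act A \<xi> \<sigma>)"
  unfolding limit_set_def
proof (rule INF_greatest)
  fix K assume "K \<in> {K. compactin (arrow_top A) K}"
  then have K: "compactin (arrow_top A) K" by simp
  let ?K' = "arrow_product K {\<xi>}"
  have cK': "compactin (arrow_top A) ?K'"
    using K \<xi> by (simp add: compactin_arrow_product topspace_arrow)
  have "act_set A (arrows A - ?K') {\<sigma>} \<subseteq> act_set A (arrows A - K) {act A \<xi> \<sigma>}"
  proof
    fix p assume "p \<in> act_set A (arrows A - ?K') {\<sigma>}"
    then obtain \<zeta> where \<zeta>: "\<zeta> \<in> arrows A" "\<zeta> \<notin> ?K'" "src A \<zeta> = anchor A \<sigma>" "p = act A \<zeta> \<sigma>"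
      by (auto simp: act_set_def)
    let ?\<theta> = "gmult A \<zeta> (ginv A \<xi>)"
    have \<theta>: "?\<theta> \<in> arrows A" "src A ?\<theta> = rng A \<xi>"
      using \<zeta> \<xi> by (simp_all add: mult_closed inv_closed rng_inv src_mult src_inv)
    have \<zeta>_eq: "gmult A ?\<theta> \<xi> = \<zeta>"
      using \<zeta> \<xi> by (simp add: mult_assoc inv_closed rng_inv src_inv inv_left)
        (metis unit_right)
    then have "?\<theta> \<notin> K"
      using \<zeta>(2) \<theta> by (force simp: arrow_product_def)
    moreover have "p = act A ?\<theta> (act A \<xi> \<sigma>)"
      using act_mult[of ?\<theta> \<xi> \<sigma>] \<theta> \<xi> \<sigma> \<zeta>_eq \<zeta> by simp
    ultimately show "p \<in> act_set A (arrows A - K) {act A \<xi> \<sigma>}"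
      using \<theta> anchor_act[OF \<xi>(1) \<sigma> \<xi>(2)] by (auto simp: act_set_def)
  qed
  then have "space_top A closure_of act_set A (arrows A - ?K') {\<sigma>}
      \<subseteq> space_top A closure_of act_set A (arrows A - K) {act A \<xi> \<sigma>}"
    by (rule closure_of_mono)
  then show "(\<Inter>K\<in>{K. compactin (arrow_top A) K}. space_top A closure_of act_set A (arrows A - K) {\<sigma>})
      \<subseteq> space_top A closure_of act_set A (arrows A - K) {act A \<xi> \<sigma>}"
    using cK' by blast
qed

lemma limit_set_orbit_eq:
  assumes \<sigma>: "\<sigma> \<in> topspace (space_top A)" and "\<tau> \<in> orbit_of A \<sigma>"
  shows "limit_set A \<tau> = limit_set A \<sigma>"
proof -
  obtain \<xi> where \<xi>: "\<xi> \<in> arrows A" "src A \<xi> = anchor A \<sigma>" and \<tau>: "\<tau> = act A \<xi> \<sigma>"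
    using assms(2) by (auto simp: orbit_of_eq act_set_def)
  have "limit_set A \<tau> \<subseteq> limit_set A (act A (ginv A \<xi>) \<tau>)"
    using \<xi> \<sigma> by (intro limit_set_act_subset) (auto simp: \<tau> act_closed inv_closed src_inv anchor_act)
  then show ?thesis
    using limit_set_act_subset[OF \<sigma> \<xi>] \<xi> \<sigma> by (auto simp: \<tau> act_inv_act)
qed

lemma closure_orbit_eq:
  assumes \<sigma>: "\<sigma> \<in> topspace (space_top A)"
  shows "space_top A closure_of orbit_of A \<sigma> = orbit_of A \<sigma> \<union> limit_set A \<sigma>"
proof
  show "orbit_of A \<sigma> \<union> limit_set A \<sigma> \<subseteq> space_top A closure_of orbit_of A \<sigma>"
  proof (rule Un_least)
    show "orbit_of A \<sigma> \<subseteq> space_top A closure_of orbit_of A \<sigma>"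
      by (rule closure_of_subset[OF orbit_subset_topspace[OF \<sigma>]])
    \<comment> \<open>the orbit is the tail avoiding the empty set\<close>
    show "limit_set A \<sigma> \<subseteq> space_top A closure_of orbit_of A \<sigma>"
      unfolding limit_set_def orbit_of_eq by (rule INF_lower2[of "{}"]) auto
  qed
  have "space_top A closure_of orbit_of A \<sigma>
      \<subseteq> orbit_of A \<sigma> \<union> space_top A closure_of act_set A (arrows A - K) {\<sigma>}"
    if K: "compactin (arrow_top A) K" for K
  proof -
    have "K \<subseteq> arrows A"
      using compactin_subset_topspace[OF K] by (simp add: topspace_arrow)
    then have split: "orbit_of A \<sigma> = act_set A K {\<sigma>} \<union> act_set A (arrows A - K) {\<sigma>}"
      by (auto simp: orbit_of_eq act_set_def)
    have "closedin (space_top A) (act_set A K {\<sigma>})"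
      by (rule compactin_imp_closedin[OF Hausdorff_space compactin_act_point[OF K \<sigma>]])
    then have "space_top A closure_of act_set A K {\<sigma>} \<subseteq> orbit_of A \<sigma>"
      by (simp add: closure_of_closedin split)
    then show ?thesis
      by (subst split) (auto simp: closure_of_Un)
  qed
  then show "space_top A closure_of orbit_of A \<sigma> \<subseteq> orbit_of A \<sigma> \<union> limit_set A \<sigma>"
    unfolding limit_set_def by blast
qed

section \<open>Invariance of the limit set\<close>

lemma act_neighbourhoods:
  assumes "\<eta> \<in> arrows A" "\<tau> \<in> topspace (space_top A)" "src A \<eta> = anchor A \<tau>"
    and "openin (space_top A) W" "act A \<eta> \<tau> \<in> W"
  obtains U V where "openin (arrow_top A) U" "openin (space_top A) V" "\<eta> \<in> U" "\<tau> \<in> V"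
    "act_set A U V \<subseteq> W"
proof -
  let ?P = "prod_topology (arrow_top A) (space_top A)"
  let ?D = "{(\<xi>, \<sigma>). src A \<xi> = anchor A \<sigma>}"
  let ?N = "{p \<in> topspace (subtopology ?P ?D). (\<lambda>(\<xi>, \<sigma>). act A \<xi> \<sigma>) p \<in> W}"
  have "openin (subtopology ?P ?D) ?N"
    by (rule openin_continuous_map_preimage[OF continuous_act assms(4)])
  then obtain T where T: "openin ?P T" "?N = T \<inter> ?D"
    by (auto simp: openin_subtopology)
  have "(\<eta>, \<tau>) \<in> ?N"
    using assms by (auto simp: topspace_arrow)
  then have "(\<eta>, \<tau>) \<in> T"
    using T by blast
  then obtain U V where "openin (arrow_top A) U" "openin (space_top A) V" "\<eta> \<in> U" "\<tau> \<in> V"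
      and UV: "U \<times> V \<subseteq> T"
    using T(1) unfolding openin_prod_topology_alt by metis
  moreover have "act_set A U V \<subseteq> W"
  proof
    fix p assume "p \<in> act_set A U V"
    then obtain \<xi> \<upsilon> where p: "p = act A \<xi> \<upsilon>" "\<xi> \<in> U" "\<upsilon> \<in> V" "src A \<xi> = anchor A \<upsilon>"
      by (auto simp: act_set_def)
    then have "(\<xi>, \<upsilon>) \<in> ?N"
      unfolding T(2) using UV by blast
    then show "p \<in> W"
      using p by simp
  qed
  ultimately show ?thesis
    using that by blast
qed

text \<open>An arrow \<open>\<eta>'\<close> near \<open>\<eta>\<close>, taken from a compact set \<open>C\<close>, can carry \<open>\<xi>\<close> into \<open>K\<close> only if
  \<open>\<xi> \<in> C\<inverse>K\<close>. The arrow \<open>\<eta>\<close> itself need not act on the points of the orbit near \<open>\<tau>\<close>, whose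
  anchors vary; openness of the source map supplies the replacement \<open>\<eta>'\<close>.\<close>

lemma act_limit_set:
  assumes \<sigma>: "\<sigma> \<in> topspace (space_top A)"
    and op: "open_groupoid A" and lc: "locally_compact_space (arrow_top A)"
    and \<tau>: "\<tau> \<in> limit_set A \<sigma>" and \<eta>: "\<eta> \<in> arrows A" "src A \<eta> = anchor A \<tau>"
  shows "act A \<eta> \<tau> \<in> limit_set A \<sigma>"
  unfolding limit_set_def
proof (rule INT_I)
  fix K assume "K \<in> {K. compactin (arrow_top A) K}"
  then have K: "compactin (arrow_top A) K" by simp
  have \<tau>S: "\<tau> \<in> topspace (space_top A)"
    using \<tau> closedin_subset[OF closedin_limit_set] by blast
  show "act A \<eta> \<tau> \<in> space_top A closure_of act_set A (arrows A - K) {\<sigma>}"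
    unfolding in_closure_of
  proof (intro conjI allI impI)
    show "act A \<eta> \<tau> \<in> topspace (space_top A)"
      using \<eta> \<tau>S by (simp add: act_closed)
  next
    fix W assume "act A \<eta> \<tau> \<in> W \<and> openin (space_top A) W"
    then obtain U0 V where U0: "openin (arrow_top A) U0" "\<eta> \<in> U0"
      and V: "openin (space_top A) V" "\<tau> \<in> V" and U0V: "act_set A U0 V \<subseteq> W"
      using act_neighbourhoods[OF \<eta>(1) \<tau>S \<eta>(2)] by metis
    obtain U1 C where U1: "openin (arrow_top A) U1" "\<eta> \<in> U1"
      and C: "compactin (arrow_top A) C" "U1 \<subseteq> C"
      using lc \<eta>(1) unfolding locally_compact_space_def topspace_arrow by metis
    let ?U = "U0 \<inter> U1"
    have "openin (unit_top A) (src A ` ?U)"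
      using op U0 U1 by (auto simp: open_groupoid_def open_map_def)
    then have "openin (space_top A) {p \<in> topspace (space_top A). anchor A p \<in> src A ` ?U}"
      by (rule openin_continuous_map_preimage[OF continuous_anchor])
    moreover define N where "N = V \<inter> {p \<in> topspace (space_top A). anchor A p \<in> src A ` ?U}"
    ultimately have N: "openin (space_top A) N"
      using V(1) by (simp add: openin_Int)
    have \<tau>N: "\<tau> \<in> N"
      using V U0 U1 \<tau>S \<eta>(2) by (auto simp: N_def intro!: image_eqI[of _ _ \<eta>])
    have "compactin (arrow_top A) (arrow_product (ginv A ` C) K)" (is "compactin _ ?K'")
      by (intro compactin_arrow_product K image_compactin[OF C(1) continuous_inv])
    then have "\<tau> \<in> space_top A closure_of act_set A (arrows A - ?K') {\<sigma>}"
      using \<tau> by (auto simp: limit_set_def)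
    then have "\<exists>p. p \<in> act_set A (arrows A - ?K') {\<sigma>} \<and> p \<in> N"
      using N \<tau>N by (simp add: in_closure_of)
    then obtain \<xi> where \<xi>: "\<xi> \<in> arrows A" "\<xi> \<notin> ?K'" "src A \<xi> = anchor A \<sigma>" "act A \<xi> \<sigma> \<in> N"
      unfolding act_set_def by blast
    then obtain \<eta>' where \<eta>': "\<eta>' \<in> ?U" "src A \<eta>' = rng A \<xi>"
      using anchor_act[OF \<xi>(1) \<sigma> \<xi>(3)] by (auto simp: N_def)
    have \<eta>'A: "\<eta>' \<in> arrows A"
      using \<eta>'(1) U0(1) openin_subset topspace_arrow by blast
    have mem: "gmult A \<eta>' \<xi> \<in> arrows A"
      using \<eta>'A \<xi> \<eta>' by (simp add: mult_closed)
    have "gmult A \<eta>' \<xi> \<notin> K"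
    proof
      assume "gmult A \<eta>' \<xi> \<in> K"
      moreover have "\<xi> = gmult A (ginv A \<eta>') (gmult A \<eta>' \<xi>)"
        using \<eta>'A \<eta>' \<xi> mult_assoc[of "ginv A \<eta>'" \<eta>' \<xi>]
        by (simp add: inv_closed src_inv inv_left unit_left)
      moreover have "src A (ginv A \<eta>') = rng A (gmult A \<eta>' \<xi>)"
        using \<eta>'A \<eta>' \<xi> by (simp add: src_inv rng_mult)
      moreover have "ginv A \<eta>' \<in> ginv A ` C"
        using \<eta>' C by blast
      ultimately have "\<xi> \<in> ?K'"
        unfolding arrow_product_def by blast
      with \<xi>(2) show False ..
    qed
    then have "act A (gmult A \<eta>' \<xi>) \<sigma> \<in> act_set A (arrows A - K) {\<sigma>}"
      using mem \<xi> \<eta>' \<eta>'A by (auto simp: act_set_def src_mult)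
    moreover have "act A (gmult A \<eta>' \<xi>) \<sigma> \<in> act_set A U0 V"
    proof -
      have "\<eta>' \<in> U0" "act A \<xi> \<sigma> \<in> V" "src A \<eta>' = anchor A (act A \<xi> \<sigma>)"
        using \<eta>' \<xi>(4) anchor_act[OF \<xi>(1) \<sigma> \<xi>(3)] by (auto simp: N_def)
      then have "act A \<eta>' (act A \<xi> \<sigma>) \<in> act_set A U0 V"
        unfolding act_set_def by blast
      then show ?thesis
        using act_mult[OF \<eta>'A \<xi>(1) \<sigma> \<eta>'(2) \<xi>(3)] by simp
    qed
    ultimately show "\<exists>y. y \<in> act_set A (arrows A - K) {\<sigma>} \<and> y \<in> W"
      using U0V by blast
  qed
qed

section \<open>Attraction\<close>

text \<open>Outside an open \<open>U\<close> containing the limit set, the orbit closure is compact and covered by the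
  complements of the closures of the tails. Finitely many of these suffice, and the union of the
  corresponding compact sets of arrows is a single one whose tail stays in \<open>U\<close>.\<close>

lemma tail_subset_neighbourhood:
  assumes \<sigma>: "\<sigma> \<in> topspace (space_top A)"
    and rc: "relatively_compactin (space_top A) (orbit_of A \<sigma>)"
    and U: "openin (space_top A) U" "limit_set A \<sigma> \<subseteq> U"
  obtains K where "compactin (arrow_top A) K" "act_set A (arrows A - K) {\<sigma>} \<subseteq> U"
proof -
  define E where "E K = space_top A closure_of act_set A (arrows A - K) {\<sigma>}" for K
  let ?Q = "space_top A closure_of orbit_of A \<sigma> - U"
  let ?\<C> = "{K. compactin (arrow_top A) K}"
  have "closedin (space_top A) (topspace (space_top A) - U)"
    using U(1) by blast
  then have "compactin (space_top A)
      ((topspace (space_top A) - U) \<inter> space_top A closure_of orbit_of A \<sigma>)"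
    using rc by (intro closed_Int_compactin) (auto simp: relatively_compactin_def)
  also have "(topspace (space_top A) - U) \<inter> space_top A closure_of orbit_of A \<sigma> = ?Q"
    using closure_of_subset_topspace by fastforce
  finally have Q: "compactin (space_top A) ?Q" .
  have "?Q \<subseteq> \<Union> ((\<lambda>K. topspace (space_top A) - E K) ` ?\<C>)"
  proof
    fix p assume p: "p \<in> ?Q"
    then have "p \<notin> limit_set A \<sigma>"
      using U(2) by blast
    then obtain K where "K \<in> ?\<C>" "p \<notin> E K"
      by (auto simp: limit_set_def E_def)
    moreover have "p \<in> topspace (space_top A)"
      using p closure_of_subset_topspace by fastforce
    ultimately show "p \<in> \<Union> ((\<lambda>K. topspace (space_top A) - E K) ` ?\<C>)"
      by blast
  qed
  moreover have "openin (space_top A) (topspace (space_top A) - E K)" for K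
    by (auto simp: E_def)
  ultimately obtain \<F> where "finite \<F>" "\<F> \<subseteq> (\<lambda>K. topspace (space_top A) - E K) ` ?\<C>" "?Q \<subseteq> \<Union>\<F>"
    using compactinD[OF Q, of "(\<lambda>K. topspace (space_top A) - E K) ` ?\<C>"] by blast
  then obtain \<K> where \<K>: "\<K> \<subseteq> ?\<C>" "finite \<K>" "?Q \<subseteq> (\<Union>K\<in>\<K>. topspace (space_top A) - E K)"
    by (metis finite_subset_image)
  have cK: "compactin (arrow_top A) (\<Union>\<K>)"
    using \<K> by (intro compactin_Union) auto
  have tail_orbit: "act_set A (arrows A - \<Union>\<K>) {\<sigma>} \<subseteq> orbit_of A \<sigma>"
    by (auto simp: orbit_of_eq act_set_def)
  have "act_set A (arrows A - \<Union>\<K>) {\<sigma>} \<subseteq> U"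
  proof (rule ccontr)
    assume "\<not> act_set A (arrows A - \<Union>\<K>) {\<sigma>} \<subseteq> U"
    then obtain p where p: "p \<in> act_set A (arrows A - \<Union>\<K>) {\<sigma>}" "p \<notin> U"
      by blast
    have pS: "p \<in> orbit_of A \<sigma>" "p \<in> topspace (space_top A)"
      using p tail_orbit orbit_subset_topspace[OF \<sigma>] by blast+
    then have "p \<in> ?Q"
      using p(2) closure_of_subset[OF orbit_subset_topspace[OF \<sigma>]] by blast
    then obtain K where K: "K \<in> \<K>" "p \<notin> E K"
      using \<K>(3) by blast
    have "p \<in> act_set A (arrows A - K) {\<sigma>}"
      using p(1) K(1) by (auto simp: act_set_def)
    then have "p \<in> E K"
      using pS(2) unfolding E_def in_closure_of by blast
    with K(2) show False ..
  qed
  with cK show ?thesis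
    using that by blast
qed

lemma fibre_tail_subset_neighbourhood:
  assumes \<sigma>: "\<sigma> \<in> topspace (space_top A)"
    and rc: "relatively_compactin (space_top A) (orbit_of A \<sigma>)"
    and W: "neighbourhood_of_set (space_top A) (limit_set A \<sigma>) W"
  shows "\<exists>k. k \<subseteq> src_fibre A (anchor A \<sigma>) \<and> compactin (arrow_top A) k \<and>
    act_set A (src_fibre A (anchor A \<sigma>) - k) {\<sigma>} \<subseteq> W"
proof -
  obtain U where U: "openin (space_top A) U" "limit_set A \<sigma> \<subseteq> U" "U \<subseteq> W"
    using W by (auto simp: neighbourhood_of_set_def)
  obtain K where K: "compactin (arrow_top A) K" "act_set A (arrows A - K) {\<sigma>} \<subseteq> U"
    using tail_subset_neighbourhood[OF \<sigma> rc U(1,2)] .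
  let ?F = "src_fibre A (anchor A \<sigma>)"
  have "compactin (arrow_top A) (?F \<inter> K)"
    by (rule closed_Int_compactin[OF closedin_src_fibre K(1)])
  moreover have "act_set A (?F - ?F \<inter> K) {\<sigma>} \<subseteq> act_set A (arrows A - K) {\<sigma>}"
    by (auto simp: act_set_def src_fibre_def)
  ultimately show ?thesis
    using K(2) U(3) by (intro exI[of _ "?F \<inter> K"]) auto
qed

text \<open>If the limit set were empty, it would have the empty neighbourhood, so that some compact
  subset of the source fibre would have an empty tail, that is, would be the whole fibre.\<close>

lemma limit_set_nonempty:
  assumes \<sigma>: "\<sigma> \<in> topspace (space_top A)" and nc: "strongly_noncompact A"
    and rc: "relatively_compactin (space_top A) (orbit_of A \<sigma>)"
  shows "limit_set A \<sigma> \<noteq> {}"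
proof
  assume "limit_set A \<sigma> = {}"
  then have "neighbourhood_of_set (space_top A) (limit_set A \<sigma>) {}"
    by (auto simp: neighbourhood_of_set_def)
  then obtain k where k: "k \<subseteq> src_fibre A (anchor A \<sigma>)" "compactin (arrow_top A) k"
      "act_set A (src_fibre A (anchor A \<sigma>) - k) {\<sigma>} \<subseteq> {}"
    using fibre_tail_subset_neighbourhood[OF \<sigma> rc] by blast
  then have "k = src_fibre A (anchor A \<sigma>)"
    by (auto simp: act_set_def src_fibre_def)
  with k(2) nc anchor_unit[OF \<sigma>] show False
    by (auto simp: strongly_noncompact_def)
qed

end

theorem proposition5p5:
  fixes A :: "('g, 's) groupoid_action" and \<sigma> :: 's
  assumes "continuous_groupoid_action A"
    and "strongly_noncompact A"
    and "\<sigma> \<in> topspace (space_top A)"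
  shows "((\<forall>\<tau>\<in>orbit_of A \<sigma>. limit_set A \<tau> = limit_set A \<sigma>) \<and>
          space_top A closure_of orbit_of A \<sigma> = orbit_of A \<sigma> \<union> limit_set A \<sigma>)
       \<and> (open_groupoid A \<and> locally_compact_space (arrow_top A) \<longrightarrow>
          closedin (space_top A) (limit_set A \<sigma>) \<and> invariant_set A (limit_set A \<sigma>))
       \<and> (relatively_compactin (space_top A) (orbit_of A \<sigma>) \<longrightarrow>
          limit_set A \<sigma> \<noteq> {} \<and>
          (\<forall>W. neighbourhood_of_set (space_top A) (limit_set A \<sigma>) W \<longrightarrow>
             (\<exists>k. k \<subseteq> src_fibre A (anchor A \<sigma>) \<and> compactin (arrow_top A) k \<and>
                  act_set A (src_fibre A (anchor A \<sigma>) - k) {\<sigma>} \<subseteq> W)))"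
proof -
  interpret continuous_groupoid_action A by fact
  note \<sigma> = \<open>\<sigma> \<in> topspace (space_top A)\<close>
  have "invariant_set A (limit_set A \<sigma>)"
    if "open_groupoid A" "locally_compact_space (arrow_top A)"
    using act_limit_set[OF \<sigma> that] closedin_subset[OF closedin_limit_set]
    by (auto simp: invariant_set_def act_set_def)
  then show ?thesis
    using limit_set_orbit_eq[OF \<sigma>] closure_orbit_eq[OF \<sigma>] closedin_limit_set
      limit_set_nonempty[OF \<sigma> assms(2)] fibre_tail_subset_neighbourhood[OF \<sigma>]
    by simp
qed

end
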